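(* For $\rho,\kappa,\delta>0$ and $\frac12\le\alpha<1$ let $$\omega(\xi)=\left(\frac{2\kappa}{\rho\,\delta^{2\alpha}}\int_{-1}^{1}\frac{1-\cos(\xi\delta z)}{|z|^{1+2\alpha}}\,dz\right)^{1/2},\qquad \xi\in\mathbb R.$$ Given $b>0$, there exists $C>0$, depending only on $b$ and $\delta$, such that for all $\xi\in\mathbb R\setminus(-b,b)$ $$\left|\frac{\sqrt{(1-\alpha)\rho}\;\omega(\xi)}{\sqrt\kappa\,|\xi|^\alpha}-1\right|\le\sqrt{C(1-\alpha)}.$$ Also, there exists $c\in\left(0,\frac12\right)$, depending only on $b$, $\delta$ and $\kappa$, such that if $1-\alpha\le c$ then, for all $\xi\in\mathbb R\setminus(-b,b)$, $$\left|\log\frac{\sqrt{(1-\alpha)\rho}\;\omega(\xi)}{\sqrt\kappa}-\alpha\log|\xi|\right|\le\sqrt{C(1-\alpha)}.$$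
   Context: "Depending only on" means that the constants are chosen uniformly with respect to all the remaining parameters: $C$ does not depend on $\alpha\in[\frac12,1)$, $\kappa$, $\rho$, $\xi$, and $c$ does not depend on $\alpha$, $\rho$, $\xi$. *)

theory Defs
  imports "HOL-Analysis.Analysis"
begin

text \<open>
  The integral is the Lebesgue integral. With Isabelle's conventions the integrand takes the
  value 0 at \<open>z = 0\<close>, a null set, where the quotient is mathematically undefined.
\<close>

definition omega :: "real \<Rightarrow> real \<Rightarrow> real \<Rightarrow> real \<Rightarrow> real \<Rightarrow> real" where
  "omega \<rho> \<kappa> \<delta> \<alpha> \<xi> =
     sqrt (2 * \<kappa> / (\<rho> * \<delta> powr (2 * \<alpha>)) *
           (LBINT z:{-1..1}. (1 - cos (\<xi> * \<delta> * z)) / \<bar>z\<bar> powr (1 + 2 * \<alpha>)))"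

end

theory Submission
  imports Defs
begin

text \<open>
  The substitution \<open>u = \<bar>\<xi>\<bar> \<delta> z\<close> turns the square of the normalized frequency
  \<open>sqrt ((1 - \<alpha>) \<rho>) \<omega>(\<xi>) / (sqrt \<kappa> \<bar>\<xi>\<bar>^\<alpha>)\<close> into
  \<open>Q = 4 (1 - \<alpha>) \<integral>_0^t (1 - cos u) / u^(1 + 2 \<alpha>) du\<close> with \<open>t = \<bar>\<xi>\<bar> \<delta>\<close>: the parameters
  \<open>\<rho>\<close> and \<open>\<kappa>\<close> cancel, and \<open>\<xi>\<close> survives only in the upper limit, which is at least
  \<open>b \<delta>\<close> (lemma \<open>normalized_omega_eq\<close>).

  As \<open>\<alpha>\<close> tends to 1 the integral blows up, but only through its behaviour at 0. There the
  integrand is close to \<open>u^(1 - 2 \<alpha>) / 2\<close>, whose integral over \<open>[0, m]\<close> is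
  \<open>m^(2 - 2 \<alpha>) / (4 (1 - \<alpha>))\<close>; the prefactor turns this into \<open>m^(2 - 2 \<alpha>)\<close>, which is
  \<open>1 + O(1 - \<alpha>)\<close>. What is left over near 0, and the whole integral beyond \<open>m\<close>, are bounded
  uniformly in \<open>\<alpha>\<close> and \<open>t\<close>, hence contribute \<open>O(1 - \<alpha>)\<close> to \<open>Q\<close>. Cutting at
  \<open>m = min 1 (b \<delta>)\<close> gives \<open>\<bar>Q - 1\<bar> \<le> C (1 - \<alpha>)\<close> with \<open>C\<close> depending on \<open>b \<delta>\<close> alone
  (lemma \<open>normalized_cos_kernel_integral_near_1\<close>).

  The normalized frequency is \<open>sqrt Q\<close>. The first estimate is then
  \<open>\<bar>sqrt Q - 1\<bar> \<le> sqrt \<bar>Q - 1\<bar>\<close>. For the second, the logarithm in question is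
  \<open>ln (sqrt Q)\<close>, which is at most \<open>\<bar>Q - 1\<bar>\<close> in absolute value once \<open>C (1 - \<alpha>) \<le> 1/2\<close>
  keeps \<open>Q\<close> away from 0; and a number in \<open>[0, 1]\<close> is at most its square root.
\<close>

section \<open>The kernel and its integral\<close>

text \<open>
  The absolute value makes the kernel even, so that the integral over \<open>[-1, 1]\<close> reduces to one
  over the positive half axis.
\<close>

definition cos_kernel :: "real \<Rightarrow> real \<Rightarrow> real" where
  "cos_kernel p u = (1 - cos u) / \<bar>u\<bar> powr p"

lemma cos_kernel_nonneg: "0 \<le> cos_kernel p u"
  by (simp add: cos_kernel_def)

lemma cos_kernel_minus: "cos_kernel p (- u) = cos_kernel p u"
  by (simp add: cos_kernel_def)

lemma borel_measurable_cos_kernel: "cos_kernel p \<in> borel_measurable borel"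
  unfolding cos_kernel_def by measurable

text \<open>
  The fourth-order remainder makes the error, divided by \<open>u powr p\<close>, integrable at 0 uniformly
  in \<open>p \<le> 3\<close>.
\<close>

lemma cos_quadratic_error: "\<bar>1 - cos x - x\<^sup>2 / 2\<bar> \<le> x ^ 4 / 24" for x :: real
proof -
  obtain t where t: "cos x = (\<Sum>m<4. cos_coeff m * x ^ m)
      + cos (t + 1/2 * real (4::nat) * pi) / fact 4 * x ^ 4"
    using Maclaurin_cos_expansion[of x 4] by blast
  have "(\<Sum>m<4. cos_coeff m * x ^ m) = 1 - x\<^sup>2 / 2"
    by (simp add: eval_nat_numeral cos_coeff_Suc sin_coeff_Suc)
  with t have "1 - cos x - x\<^sup>2 / 2 = - (cos (t + 1/2 * real (4::nat) * pi) * (x ^ 4 / 24))"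
    by (simp add: fact_numeral)
  then have "\<bar>1 - cos x - x\<^sup>2 / 2\<bar> = \<bar>cos (t + 1/2 * real (4::nat) * pi)\<bar> * (x ^ 4 / 24)"
    by (simp add: abs_mult)
  also have "\<dots> \<le> 1 * (x ^ 4 / 24)"
    by (intro mult_right_mono abs_cos_le_one) auto
  finally show ?thesis by simp
qed

lemma one_minus_cos_le: "1 - cos x \<le> x\<^sup>2 / 2" for x :: real
proof -
  have "1 - cos x = 2 * (sin (x / 2))\<^sup>2"
    using cos_double_sin[of "x / 2"] by simp
  also have "(sin (x / 2))\<^sup>2 \<le> (x / 2)\<^sup>2"
    by (metis abs_le_square_iff abs_sin_x_le_abs_x)
  finally show ?thesis by (simp add: power2_eq_square)
qed

text \<open>
  Both sides vanish at \<open>u = 0\<close>, since division by 0 and \<open>0 powr a\<close> both give 0; this spares the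
  pointwise comparisons below a case distinction at the singularity.
\<close>

lemma power_div_powr: "u ^ n / \<bar>u\<bar> powr p = u powr (real n - p)" if "u \<ge> 0" "n > 0"
  using that by (cases "u = 0") (auto simp: powr_diff powr_realpow)

text \<open>
  The numerator vanishes to second order, so the kernel is dominated by \<open>u powr (2 - p) / 2\<close>,
  whose exponent exceeds \<open>-1\<close>.
\<close>

lemma cos_kernel_integrable:
  assumes "p < 3" "0 \<le> t"
  shows "cos_kernel p integrable_on {0..t}"
proof (rule measurable_bounded_by_integrable_imp_integrable)
  show "cos_kernel p \<in> borel_measurable (lebesgue_on {0..t})"
    by (intro measurable_restrict_space1 measurable_completion)
      (simp add: borel_measurable_cos_kernel)
  show "(\<lambda>u. u powr (2 - p) / 2) integrable_on {0..t}"
    using has_integral_divide[OF has_integral_powr_from_0[of "2 - p" t], of 2] assms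
    by (auto simp: has_integral_iff)
  fix u assume "u \<in> {0..t}"
  then have "u powr (2 - p) / 2 = u\<^sup>2 / 2 / \<bar>u\<bar> powr p"
    using power_div_powr[of u 2 p] by simp
  then show "norm (cos_kernel p u) \<le> u powr (2 - p) / 2"
    using divide_right_mono[OF one_minus_cos_le[of u], of "\<bar>u\<bar> powr p"] cos_kernel_nonneg[of p u]
    by (simp only: cos_kernel_def real_norm_def abs_of_nonneg powr_ge_zero)
qed auto

text \<open>
  Replacing \<open>1 - cos u\<close> by \<open>u\<^sup>2 / 2\<close> isolates the term that is singular as \<open>p\<close> tends to 3;
  the error bound stays finite there.
\<close>

lemma integral_cos_kernel_near_zero:
  assumes "p < 3" "0 \<le> m"
  shows "\<bar>integral {0..m} (cos_kernel p) - m powr (3 - p) / (2 * (3 - p))\<bar>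
           \<le> m powr (5 - p) / (24 * (5 - p))"
proof -
  have *: "((\<lambda>u. u powr (2 - p) / 2) has_integral m powr (3 - p) / (3 - p) / 2) {0..m}"
    using has_integral_divide[OF has_integral_powr_from_0[of "2 - p" m], of 2] assms by simp
  have **: "((\<lambda>u. u powr (4 - p) / 24) has_integral m powr (5 - p) / (5 - p) / 24) {0..m}"
    using has_integral_divide[OF has_integral_powr_from_0[of "4 - p" m], of 24] assms by simp
  have k: "cos_kernel p integrable_on {0..m}"
    using assms by (rule cos_kernel_integrable)
  have "norm (integral {0..m} (\<lambda>u. cos_kernel p u - u powr (2 - p) / 2))
      \<le> integral {0..m} (\<lambda>u. u powr (4 - p) / 24)"
  proof (rule integral_norm_bound_integral)
    show "(\<lambda>u. cos_kernel p u - u powr (2 - p) / 2) integrable_on {0..m}"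
      using k * by (intro integrable_diff) (auto simp: has_integral_iff)
    show "(\<lambda>u. u powr (4 - p) / 24) integrable_on {0..m}"
      using ** by blast
    fix u assume "u \<in> {0..m}"
    then have u: "u powr (2 - p) = u\<^sup>2 / \<bar>u\<bar> powr p" "u powr (4 - p) = u ^ 4 / \<bar>u\<bar> powr p"
      using power_div_powr[of u 2 p] power_div_powr[of u 4 p] by auto
    have "cos_kernel p u - u powr (2 - p) / 2 = (1 - cos u - u\<^sup>2 / 2) / \<bar>u\<bar> powr p"
      by (simp add: u cos_kernel_def diff_divide_distrib)
    then show "norm (cos_kernel p u - u powr (2 - p) / 2) \<le> u powr (4 - p) / 24"
      using divide_right_mono[OF cos_quadratic_error[of u], of "\<bar>u\<bar> powr p"] by (simp add: u)
  qed
  also have "integral {0..m} (\<lambda>u. cos_kernel p u - u powr (2 - p) / 2)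
      = integral {0..m} (cos_kernel p) - m powr (3 - p) / (3 - p) / 2"
    by (intro integral_unique has_integral_diff * integrable_integral k)
  also have "integral {0..m} (\<lambda>u. u powr (4 - p) / 24) = m powr (5 - p) / (5 - p) / 24"
    using ** by (rule integral_unique)
  finally show ?thesis by (simp add: mult.commute)
qed

text \<open>
  Away from 0 the crude bound \<open>1 - cos u \<le> 2\<close> suffices: comparing with the integral over the
  whole half-line \<open>[m, \<infinity>)\<close> makes the estimate uniform in \<open>t\<close>.
\<close>

lemma integral_cos_kernel_tail:
  assumes "1 < p" "p < 3" "0 < m"
  shows "\<bar>integral {m..t} (cos_kernel p)\<bar> \<le> 2 * m powr (1 - p) / (p - 1)"
proof -
  have h: "((\<lambda>u. 2 * u powr (- p)) has_integral 2 * m powr (1 - p) / (p - 1)) {m..}"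
  proof -
    have "- (m powr (- p + 1)) / (- p + 1) = m powr (1 - p) / (p - 1)"
      using minus_divide_divide[of "m powr (1 - p)" "p - 1"] by simp
    then show ?thesis
      using has_integral_mult_right[OF has_integral_powr_to_inf[of "- p" m], of 2] assms
      by (simp only:) auto
  qed
  have i: "(\<lambda>u. 2 * u powr (- p)) integrable_on {m..t}"
    using assms by (intro integrable_continuous_interval continuous_intros) auto
  have "cos_kernel p integrable_on {m..t}"
  proof (cases "m \<le> t")
    case True
    then show ?thesis
      using cos_kernel_integrable[of p t] assms
      by (auto intro: integrable_subinterval_real)
  qed auto
  then have "norm (integral {m..t} (cos_kernel p)) \<le> integral {m..t} (\<lambda>u. 2 * u powr (- p))"
  proof (rule integral_norm_bound_integral[OF _ i])
    fix u assume "u \<in> {m..t}"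
    then show "norm (cos_kernel p u) \<le> 2 * u powr (- p)"
      using assms divide_right_mono[of "1 - cos u" 2 "u powr p"] cos_ge_minus_one[of u]
      by (simp add: cos_kernel_def powr_minus divide_inverse)
  qed
  also have "\<dots> \<le> integral {m..} (\<lambda>u. 2 * u powr (- p))"
    using h i by (intro integral_subset_le) auto
  also have "\<dots> = 2 * m powr (1 - p) / (p - 1)"
    using h by (rule integral_unique)
  finally show ?thesis by simp
qed

text \<open>
  The three summands of the constant have three sources: 1 is the quadratic approximation error on
  \<open>[0, m]\<close>, \<open>4 / m\<^sup>2\<close> is the tail, and \<open>- ln m\<close> measures how far the main term
  \<open>m powr (3 - p)\<close> is from 1.
\<close>

lemma normalized_cos_kernel_integral_near_1:
  assumes p: "2 \<le> p" "p < 3" and m: "0 < m" "m \<le> 1" "m \<le> t"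
  shows "\<bar>2 * (3 - p) * integral {0..t} (cos_kernel p) - 1\<bar> \<le> (3 - p) * (1 + 4 / m\<^sup>2 - ln m)"
proof -
  define s where "s = 3 - p"
  have s: "0 < s" "s \<le> 1" and p_eq: "p = 3 - s" using p by (auto simp: s_def)
  define A where "A = integral {0..m} (cos_kernel p)"
  define B where "B = integral {m..t} (cos_kernel p)"
  have split: "integral {0..t} (cos_kernel p) = A + B"
    unfolding A_def B_def
    using cos_kernel_integrable[of p t] p m
    by (intro Henstock_Kurzweil_Integration.integral_combine[symmetric]) auto
  have "\<bar>A - m powr s / (2 * s)\<bar> \<le> m powr (2 + s) / (24 * (2 + s))"
    using integral_cos_kernel_near_zero[of p m] p m by (simp add: A_def p_eq add.commute)
  also have "\<dots> \<le> 1 / 2"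
  proof -
    have "m powr (2 + s) \<le> 1" using m s by (simp add: powr_le1)
    then show ?thesis using s by (simp add: divide_le_eq)
  qed
  finally have A: "\<bar>2 * s * A - m powr s\<bar> \<le> s"
    using mult_left_mono[of "\<bar>A - m powr s / (2 * s)\<bar>" "1 / 2" "2 * s"] s
    by (simp add: abs_mult_pos' right_diff_distrib abs_mult)
  have "\<bar>B\<bar> \<le> 2 * m powr (s - 2) / (2 - s)"
    using integral_cos_kernel_tail[of p m t] p m by (simp add: B_def p_eq)
  also have "\<dots> \<le> 2 * m powr (s - 2)"
    using s by (simp add: divide_le_eq mult_le_cancel_left1)
  also have "m powr (s - 2) \<le> m powr (- 2)"
    using m s by (intro powr_mono') auto
  also have "m powr (- 2) = 1 / m\<^sup>2"
    using m by (simp add: powr_minus divide_inverse powr_numeral)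
  finally have B: "\<bar>2 * s * B\<bar> \<le> s * (4 / m\<^sup>2)"
    using mult_left_mono[of "\<bar>B\<bar>" "2 * (1 / m\<^sup>2)" "2 * s"] s
    by (simp add: abs_mult mult.commute)
  have "1 + s * ln m \<le> m powr s"
    using exp_ge_add_one_self[of "s * ln m"] m by (simp add: powr_def)
  moreover have "m powr s \<le> 1" using m s by (simp add: powr_le1)
  ultimately have "\<bar>m powr s - 1\<bar> \<le> s * (- ln m)" by simp
  with A B have "\<bar>2 * s * (A + B) - 1\<bar> \<le> s + s * (4 / m\<^sup>2) + s * (- ln m)"
    unfolding distrib_left by linarith
  then show ?thesis
    unfolding split s_def[symmetric] by (simp add: algebra_simps)
qed

section \<open>The frequency as a rescaled kernel integral\<close>

text \<open>
  Evenness and the substitution \<open>u = \<bar>x\<bar> z\<close>. Nonnegativity of the integrand is what lets the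
  Henstock-Kurzweil integral, for which the substitution is carried out, be read as a Lebesgue
  integral.
\<close>

lemma lborel_integral_scaled_cos_kernel:
  assumes "p < 3" "x \<noteq> 0"
  shows "(LBINT z:{-1..1}. (1 - cos (x * z)) / \<bar>z\<bar> powr p)
           = 2 * \<bar>x\<bar> powr (p - 1) * integral {0..\<bar>x\<bar>} (cos_kernel p)"
proof -
  define f where "f z = (1 - cos (x * z)) / \<bar>z\<bar> powr p" for z
  define t where "t = \<bar>x\<bar>"
  define I where "I = integral {0..t} (cos_kernel p)"
  have t: "t > 0" using assms by (simp add: t_def)
  have f: "f z = t powr p * cos_kernel p (t * z)" for z
  proof -
    have "cos (x * z) = cos (t * z)" by (auto simp: t_def abs_if)
    then show ?thesis using t by (simp add: f_def cos_kernel_def abs_mult powr_mult)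
  qed
  have "(cos_kernel p has_integral I) {0..t}"
    using cos_kernel_integrable[of p t] assms t by (simp add: I_def has_integral_integral)
  then have "((\<lambda>z. cos_kernel p (t * z)) has_integral I / t) {0..1}"
    using has_integral_stretch_real[of "cos_kernel p" I 0 t t] t by simp
  from has_integral_mult_right[OF this, of "t powr p"]
  have r: "(f has_integral t powr (p - 1) * I) {0..1}"
    using t by (simp add: f[abs_def] powr_diff)
  then have "((\<lambda>z. f (- z)) has_integral t powr (p - 1) * I) {- 1..- 0}"
    by (subst has_integral_reflect_real)
  then have l: "(f has_integral t powr (p - 1) * I) {- 1..0}"
    by (simp add: f[abs_def] cos_kernel_minus)
  have "(f has_integral t powr (p - 1) * I + t powr (p - 1) * I) {-1..1}"
    by (rule has_integral_combine[OF _ _ l r]) auto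
  then have all: "(f has_integral 2 * t powr (p - 1) * I) {-1..1}"
    by (simp only: distrib_right mult_2)
  then have "f absolutely_integrable_on {-1..1}"
    by (intro nonnegative_absolutely_integrable_1) (auto simp: f cos_kernel_nonneg)
  then have "set_integrable lborel {-1..1} f"
    unfolding set_integrable_def f_def by (subst (asm) integrable_completion) auto
  from set_borel_integral_eq_integral(2)[OF this] integral_unique[OF all]
  show ?thesis by (simp add: f_def t_def I_def)
qed

text \<open>
  The factors \<open>\<rho>\<close>, \<open>\<kappa>\<close> and \<open>\<delta> powr (2 * \<alpha>)\<close> cancel, and \<open>\<bar>\<xi>\<bar> powr (2 * \<alpha>)\<close> leaves the root as
  \<open>\<bar>\<xi>\<bar> powr \<alpha>\<close>. The statement keeps this factor on the right because one estimate divides by it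
  while the other takes its logarithm.
\<close>

lemma normalized_omega_eq:
  assumes "\<alpha> < 1" "\<rho> > 0" "\<kappa> > 0" "\<delta> > 0" "\<xi> \<noteq> 0"
  shows "sqrt ((1 - \<alpha>) * \<rho>) * omega \<rho> \<kappa> \<delta> \<alpha> \<xi> / sqrt \<kappa>
    = \<bar>\<xi>\<bar> powr \<alpha> * sqrt (4 * (1 - \<alpha>) * integral {0..\<bar>\<xi>\<bar> * \<delta>} (cos_kernel (1 + 2 * \<alpha>)))"
proof -
  define I where "I = integral {0..\<bar>\<xi>\<bar> * \<delta>} (cos_kernel (1 + 2 * \<alpha>))"
  have sq: "sqrt (\<bar>\<xi>\<bar> powr (2 * \<alpha>)) = \<bar>\<xi>\<bar> powr \<alpha>"
    using assms by (simp add: powr_half_sqrt[symmetric] powr_powr)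
  have "(LBINT z:{-1..1}. (1 - cos (\<xi> * \<delta> * z)) / \<bar>z\<bar> powr (1 + 2 * \<alpha>))
      = 2 * (\<bar>\<xi>\<bar> powr (2 * \<alpha>) * \<delta> powr (2 * \<alpha>)) * I"
    using lborel_integral_scaled_cos_kernel[of "1 + 2 * \<alpha>" "\<xi> * \<delta>"] assms
    by (simp add: I_def abs_mult powr_mult)
  then have "sqrt ((1 - \<alpha>) * \<rho>) * omega \<rho> \<kappa> \<delta> \<alpha> \<xi> / sqrt \<kappa>
    = sqrt ((1 - \<alpha>) * \<rho> * (2 * \<kappa> / (\<rho> * \<delta> powr (2 * \<alpha>))
        * (2 * (\<bar>\<xi>\<bar> powr (2 * \<alpha>) * \<delta> powr (2 * \<alpha>)) * I)) / \<kappa>)"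
    by (simp only: omega_def real_sqrt_mult real_sqrt_divide)
  also have "(1 - \<alpha>) * \<rho> * (2 * \<kappa> / (\<rho> * \<delta> powr (2 * \<alpha>))
        * (2 * (\<bar>\<xi>\<bar> powr (2 * \<alpha>) * \<delta> powr (2 * \<alpha>)) * I)) / \<kappa>
    = \<bar>\<xi>\<bar> powr (2 * \<alpha>) * (4 * (1 - \<alpha>) * I)"
    using assms by (simp add: field_simps)
  also have "sqrt \<dots> = \<bar>\<xi>\<bar> powr \<alpha> * sqrt (4 * (1 - \<alpha>) * I)"
    by (simp only: real_sqrt_mult sq)
  finally show ?thesis by (simp add: I_def)
qed

section \<open>From the square to the square root and the logarithm\<close>

text \<open>
  Squared, this compares \<open>\<bar>sqrt q - 1\<bar> * \<bar>sqrt q - 1\<bar>\<close> with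
  \<open>\<bar>sqrt q - 1\<bar> * (sqrt q + 1) = \<bar>q - 1\<bar>\<close>.
\<close>

lemma abs_sqrt_minus_1_le: "\<bar>sqrt q - 1\<bar> \<le> sqrt \<bar>q - 1\<bar>" if "q \<ge> 0"
proof (rule real_le_rsqrt)
  have "\<bar>sqrt q - 1\<bar> \<le> \<bar>sqrt q + 1\<bar>"
    using real_sqrt_ge_zero[OF that] by linarith
  then have "\<bar>sqrt q - 1\<bar> * \<bar>sqrt q - 1\<bar> \<le> \<bar>sqrt q - 1\<bar> * \<bar>sqrt q + 1\<bar>"
    by (intro mult_left_mono) auto
  also have "\<dots> = \<bar>(sqrt q - 1) * (sqrt q + 1)\<bar>"
    by (simp only: abs_mult)
  also have "(sqrt q - 1) * (sqrt q + 1) = q - 1"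
    using that by (simp add: algebra_simps)
  finally show "\<bar>sqrt q - 1\<bar>\<^sup>2 \<le> \<bar>q - 1\<bar>" by (simp add: power2_eq_square)
qed

text \<open>
  From \<open>1 - 1 / q \<le> ln q \<le> q - 1\<close>: the lower bound loses a factor \<open>1 / q \<le> 2\<close>, which the
  square root gives back.
\<close>

lemma abs_ln_sqrt_le: "\<bar>ln (sqrt q)\<bar> \<le> \<bar>q - 1\<bar>" if "q \<ge> 1 / 2"
proof -
  have "- ln q \<le> 1 / q - 1"
    using ln_le_minus_one[of "1 / q"] that by (simp add: ln_div)
  also have "\<dots> = (1 - q) * (1 / q)" using that by (simp add: field_simps)
  also have "\<dots> \<le> \<bar>q - 1\<bar> * 2"
    using that by (intro mult_mono) (auto simp: field_simps)
  finally have "- ln q \<le> \<bar>q - 1\<bar> * 2" .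
  moreover have "ln q \<le> q - 1" using that by (intro ln_le_minus_one) auto
  ultimately have "\<bar>ln q\<bar> \<le> 2 * \<bar>q - 1\<bar>"
    using abs_ge_self[of "q - 1"] unfolding abs_le_iff by (auto simp: mult.commute)
  then show ?thesis using that by (simp add: ln_sqrt)
qed

section \<open>Uniform estimates of the dispersion relation\<close>

theorem theorem2p2:
  fixes b \<delta> :: real
  assumes "b > 0" and "\<delta> > 0"
  shows "\<exists>C>0.
    (\<forall>\<alpha> \<kappa> \<rho> \<xi>. 1/2 \<le> \<alpha> \<and> \<alpha> < 1 \<and> \<kappa> > 0 \<and> \<rho> > 0 \<and> \<xi> \<in> UNIV - {-b<..<b} \<longrightarrow>
       \<bar>sqrt ((1 - \<alpha>) * \<rho>) * omega \<rho> \<kappa> \<delta> \<alpha> \<xi> / (sqrt \<kappa> * \<bar>\<xi>\<bar> powr \<alpha>) - 1\<bar>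
         \<le> sqrt (C * (1 - \<alpha>))) \<and>
    (\<forall>\<kappa>>0. \<exists>c. 0 < c \<and> c < 1/2 \<and>
       (\<forall>\<alpha> \<rho> \<xi>. 1/2 \<le> \<alpha> \<and> \<alpha> < 1 \<and> \<rho> > 0 \<and> 1 - \<alpha> \<le> c \<and> \<xi> \<in> UNIV - {-b<..<b} \<longrightarrow>
          \<bar>ln (sqrt ((1 - \<alpha>) * \<rho>) * omega \<rho> \<kappa> \<delta> \<alpha> \<xi> / sqrt \<kappa>) - \<alpha> * ln \<bar>\<xi>\<bar>\<bar>
            \<le> sqrt (C * (1 - \<alpha>))))"
proof -
  define m where "m = min 1 (b * \<delta>)"
  have m: "0 < m" "m \<le> 1" "m \<le> b * \<delta>" using assms by (auto simp: m_def)
  define C where "C = 2 * (1 + 4 / m\<^sup>2 - ln m)"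
  have "C > 0"
  proof -
    have "ln m \<le> 0" using m by simp
    moreover have "0 < 1 + 4 / m\<^sup>2" by (intro add_pos_nonneg) auto
    ultimately show ?thesis by (simp add: C_def)
  qed
  define Q where "Q \<alpha> \<xi> = 4 * (1 - \<alpha>) * integral {0..\<bar>\<xi>\<bar> * \<delta>} (cos_kernel (1 + 2 * \<alpha>))"
    for \<alpha> \<xi>
  have Q_near_1: "\<bar>Q \<alpha> \<xi> - 1\<bar> \<le> C * (1 - \<alpha>)"
    if "1/2 \<le> \<alpha>" "\<alpha> < 1" "b \<le> \<bar>\<xi>\<bar>" for \<alpha> \<xi>
  proof -
    have "b * \<delta> \<le> \<bar>\<xi>\<bar> * \<delta>" using that assms by (intro mult_right_mono) auto
    then show ?thesis
      using normalized_cos_kernel_integral_near_1[of "1 + 2 * \<alpha>" m "\<bar>\<xi>\<bar> * \<delta>"] that m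
      by (simp add: Q_def C_def algebra_simps)
  qed
  have Q_nonneg: "0 \<le> Q \<alpha> \<xi>" if "\<alpha> < 1" for \<alpha> \<xi>
  proof -
    have "0 \<le> integral {0..\<bar>\<xi>\<bar> * \<delta>} (cos_kernel (1 + 2 * \<alpha>))"
      using that assms
      by (intro integral_nonneg cos_kernel_integrable) (auto simp: cos_kernel_nonneg)
    then show ?thesis using that by (simp add: Q_def)
  qed
  have first: "\<bar>sqrt ((1 - \<alpha>) * \<rho>) * omega \<rho> \<kappa> \<delta> \<alpha> \<xi> / (sqrt \<kappa> * \<bar>\<xi>\<bar> powr \<alpha>) - 1\<bar>
      \<le> sqrt (C * (1 - \<alpha>))"
    if "1/2 \<le> \<alpha>" "\<alpha> < 1" "\<kappa> > 0" "\<rho> > 0" "b \<le> \<bar>\<xi>\<bar>" for \<alpha> \<kappa> \<rho> \<xi>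
  proof -
    have "\<xi> \<noteq> 0" using that assms by auto
    then have "sqrt ((1 - \<alpha>) * \<rho>) * omega \<rho> \<kappa> \<delta> \<alpha> \<xi> / (sqrt \<kappa> * \<bar>\<xi>\<bar> powr \<alpha>)
        = sqrt (Q \<alpha> \<xi>)"
      using normalized_omega_eq[of \<alpha> \<rho> \<kappa> \<delta> \<xi>] that assms
      by (simp add: Q_def flip: divide_divide_eq_left)
    then show ?thesis
      using order_trans[OF abs_sqrt_minus_1_le[OF Q_nonneg[of \<alpha> \<xi>]], of "sqrt (C * (1 - \<alpha>))"]
        Q_near_1[of \<alpha> \<xi>] that
      by simp
  qed
  \<comment> \<open>\<open>1 / (2 * C)\<close> forces \<open>Q \<ge> 1/2\<close>; the cap \<open>1/4\<close> keeps \<open>c\<close> strictly below \<open>1/2\<close>.\<close>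
  define c where "c = min (1/4) (1 / (2 * C))"
  have c: "0 < c" "c < 1/2" using \<open>C > 0\<close> by (auto simp: c_def)
  have second: "\<bar>ln (sqrt ((1 - \<alpha>) * \<rho>) * omega \<rho> \<kappa> \<delta> \<alpha> \<xi> / sqrt \<kappa>) - \<alpha> * ln \<bar>\<xi>\<bar>\<bar>
      \<le> sqrt (C * (1 - \<alpha>))"
    if "1/2 \<le> \<alpha>" "\<alpha> < 1" "\<kappa> > 0" "\<rho> > 0" "1 - \<alpha> \<le> c" "b \<le> \<bar>\<xi>\<bar>" for \<alpha> \<kappa> \<rho> \<xi>
  proof -
    have \<xi>: "\<xi> \<noteq> 0" using that assms by auto
    have "1 - \<alpha> \<le> 1 / (2 * C)" using that by (simp add: c_def)
    then have small: "C * (1 - \<alpha>) \<le> 1 / 2" using \<open>C > 0\<close> by (simp add: field_simps)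
    have "\<bar>Q \<alpha> \<xi> - 1\<bar> \<le> C * (1 - \<alpha>)" using that by (intro Q_near_1) auto
    with small have Q: "Q \<alpha> \<xi> \<ge> 1 / 2" by linarith
    have "ln (sqrt ((1 - \<alpha>) * \<rho>) * omega \<rho> \<kappa> \<delta> \<alpha> \<xi> / sqrt \<kappa>) - \<alpha> * ln \<bar>\<xi>\<bar>
        = ln (\<bar>\<xi>\<bar> powr \<alpha> * sqrt (Q \<alpha> \<xi>)) - \<alpha> * ln \<bar>\<xi>\<bar>"
      using normalized_omega_eq[of \<alpha> \<rho> \<kappa> \<delta> \<xi>] that assms \<xi> by (simp add: Q_def)
    also have "\<dots> = ln (sqrt (Q \<alpha> \<xi>))"
      using \<xi> Q by (subst ln_mult) (auto simp: ln_powr)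
    finally have "\<bar>ln (sqrt ((1 - \<alpha>) * \<rho>) * omega \<rho> \<kappa> \<delta> \<alpha> \<xi> / sqrt \<kappa>) - \<alpha> * ln \<bar>\<xi>\<bar>\<bar>
        \<le> \<bar>Q \<alpha> \<xi> - 1\<bar>"
      using abs_ln_sqrt_le[OF Q] by simp
    also have "\<dots> \<le> C * (1 - \<alpha>)" by fact
    also have "\<dots> \<le> sqrt (C * (1 - \<alpha>))"
    proof (rule real_le_rsqrt)
      have "0 \<le> C * (1 - \<alpha>)" using \<open>C > 0\<close> that by simp
      then show "(C * (1 - \<alpha>))\<^sup>2 \<le> C * (1 - \<alpha>)"
        using small unfolding power2_eq_square by (intro mult_left_le) auto
    qed
    finally show ?thesis .
  qed
  have outside: "b \<le> \<bar>\<xi>\<bar>" if "\<xi> \<in> UNIV - {-b<..<b}" for \<xi>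
    using that by auto
  show ?thesis
  proof (intro exI[of _ C] conjI)
    show "0 < C" by fact
  next
    show "\<forall>\<kappa>>0. \<exists>c. 0 < c \<and> c < 1/2 \<and>
       (\<forall>\<alpha> \<rho> \<xi>. 1/2 \<le> \<alpha> \<and> \<alpha> < 1 \<and> \<rho> > 0 \<and> 1 - \<alpha> \<le> c \<and> \<xi> \<in> UNIV - {-b<..<b} \<longrightarrow>
          \<bar>ln (sqrt ((1 - \<alpha>) * \<rho>) * omega \<rho> \<kappa> \<delta> \<alpha> \<xi> / sqrt \<kappa>) - \<alpha> * ln \<bar>\<xi>\<bar>\<bar>
            \<le> sqrt (C * (1 - \<alpha>)))"
    proof (intro allI impI exI[of _ c] conjI c)
    qed (elim conjE, rule second; (assumption | erule outside))
  qed (intro allI impI, elim conjE, rule first; (assumption | erule outside))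
qed

end
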